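(* Let $\mathcal{H}$ be a complex separable Hilbert space and let $T$ be an algebraic bounded linear operator on $\mathcal{H}$ whose monic minimal polynomial has degree $r\ge 2$ and real coefficients, written $$P(X)=X^r-a_{r-1}X^{r-1}-\cdots-a_1X-a_0,\qquad a_0,\dots,a_{r-1}\in\mathbb{R}.$$ Let $\lambda_1,\dots,\lambda_s\in\mathbb{C}$ be the distinct roots of $P$, with respective multiplicities $m_1,\dots,m_s$, and let $C_{i,j}$ ($1\le i\le s$, $0\le j\le m_i-1$) be the bounded linear operators on $\mathcal{H}$, depending only on $T^0,\dots,T^{r-1}$, of the Binet-type representation $$T^n=\sum_{i=1}^s\sum_{j=0}^{m_i-1}C_{i,j}\,n^j\,\lambda_i^n\qquad\text{for all } n\ge 0.$$ Then the exponential of $T$ can be expressed explicitly as $$e^T=\sum_{i=1}^s\sum_{j=0}^{m_i-1}C_{i,j}\,e^{\lambda_i}\,P_j(\lambda_i),$$ where $P_j$ denotes the $j$-th Bell polynomial.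
   Context: A bounded operator $T$ on $\mathcal{H}$ is algebraic if $p(T)=0$ for some nonzero $p\in\mathbb{C}[X]$; its monic minimal polynomial is the monic polynomial of least degree annihilating $T$. $T^0$ is the identity operator, $e^T=\sum_{n=0}^\infty T^n/n!$, and $0^0=1$. The $j$-th Bell polynomial is $P_j(x)=\sum_{k=0}^jS(j,k)x^k$, where $S(j,k)$ is the Stirling number of the second kind, i.e. the number of partitions of a $j$-element set into $k$ disjoint nonempty subsets (with $S(0,0)=1$). *)

theory Defs
  imports
    "HOL-Analysis.Analysis"
    "HOL-Computational_Algebra.Polynomial"
    "HOL-Combinatorics.Stirling"
begin

section \<open>Complex Hilbert spaces\<close>

class complex_vector = real_vector +
  fixes scaleC :: "complex \<Rightarrow> 'a \<Rightarrow> 'a"  (infixr "*\<^sub>C" 75)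
  assumes scaleC_add_right: "c *\<^sub>C (x + y) = c *\<^sub>C x + c *\<^sub>C y"
    and scaleC_add_left: "(c + d) *\<^sub>C x = c *\<^sub>C x + d *\<^sub>C x"
    and scaleC_scaleC: "c *\<^sub>C d *\<^sub>C x = (c * d) *\<^sub>C x"
    and scaleC_one: "1 *\<^sub>C x = x"
    and scaleR_scaleC: "scaleR r x = complex_of_real r *\<^sub>C x"

class complex_normed_vector = complex_vector + real_normed_vector +
  assumes norm_scaleC: "norm (c *\<^sub>C x) = cmod c * norm x"

text \<open>
  The inner product is linear in its first argument. The last axiom says both that the norm is
  the one induced by the inner product and, as the norm is definite, that the inner product is
  positive definite.
\<close>

class complex_inner = complex_normed_vector +
  fixes cinner :: "'a \<Rightarrow> 'a \<Rightarrow> complex"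
  assumes cinner_commute: "cinner x y = cnj (cinner y x)"
    and cinner_add_left: "cinner (x + y) z = cinner x z + cinner y z"
    and cinner_scaleC_left: "cinner (c *\<^sub>C x) y = c * cinner x y"
    and cinner_self: "cinner x x = complex_of_real ((norm x)\<^sup>2)"

class complex_hilbert_space = complex_inner + complete_space

instantiation complex :: complex_hilbert_space
begin

definition scaleC_complex :: "complex \<Rightarrow> complex \<Rightarrow> complex"
  where "scaleC_complex c x = c * x"

definition cinner_complex :: "complex \<Rightarrow> complex \<Rightarrow> complex"
  where "cinner_complex x y = x * cnj y"

instance
proof
  fix c d x y z :: complex and r :: real
  show "c *\<^sub>C (x + y) = c *\<^sub>C x + c *\<^sub>C y" "(c + d) *\<^sub>C x = c *\<^sub>C x + d *\<^sub>C x"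
    "c *\<^sub>C d *\<^sub>C x = (c * d) *\<^sub>C x" "1 *\<^sub>C x = x"
    by (simp_all add: scaleC_complex_def distrib_left distrib_right)
  show "r *\<^sub>R x = complex_of_real r *\<^sub>C x"
    by (simp add: scaleC_complex_def scaleR_conv_of_real)
  show "norm (c *\<^sub>C x) = cmod c * norm x"
    by (simp add: scaleC_complex_def norm_mult)
  show "cinner x y = cnj (cinner y x)"
    by (simp add: cinner_complex_def)
  show "cinner (x + y) z = cinner x z + cinner y z" "cinner (c *\<^sub>C x) y = c * cinner x y"
    by (simp_all add: scaleC_complex_def cinner_complex_def distrib_right)
  show "cinner x x = complex_of_real ((norm x)\<^sup>2)"
    unfolding cinner_complex_def by (rule complex_norm_square[symmetric])
qed

end

section \<open>Bounded operators\<close>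

text \<open>
  The type of bounded linear maps consists of the real-linear ones; bounded operators on a complex
  space are those that satisfy \<open>clinear_op\<close>. Their norm, hence convergence of operator
  series, is the usual operator norm.
\<close>

definition clinear_op :: "('a::complex_normed_vector \<Rightarrow>\<^sub>L 'a) \<Rightarrow> bool"
  where "clinear_op A \<longleftrightarrow> (\<forall>c x. blinfun_apply A (c *\<^sub>C x) = c *\<^sub>C blinfun_apply A x)"

lemma bounded_linear_scaleC_blinfun:
  fixes A :: "'a::real_normed_vector \<Rightarrow>\<^sub>L 'b::complex_normed_vector"
  shows "bounded_linear (\<lambda>x. c *\<^sub>C blinfun_apply A x)"
proof (rule bounded_linear_intro[where K = "cmod c * norm A"])
  fix x y :: 'a and r :: real
  show "c *\<^sub>C blinfun_apply A (x + y) = c *\<^sub>C blinfun_apply A x + c *\<^sub>C blinfun_apply A y"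
    by (simp add: blinfun.add_right scaleC_add_right)
  show "c *\<^sub>C blinfun_apply A (r *\<^sub>R x) = r *\<^sub>R c *\<^sub>C blinfun_apply A x"
    by (simp add: blinfun.scaleR_right scaleR_scaleC scaleC_scaleC mult.commute)
  show "norm (c *\<^sub>C blinfun_apply A x) \<le> norm x * (cmod c * norm A)"
    using mult_left_mono[OF norm_blinfun[of A x], of "cmod c"]
    by (simp add: norm_scaleC mult_ac)
qed

instantiation blinfun :: (real_normed_vector, complex_normed_vector) complex_normed_vector
begin

lift_definition scaleC_blinfun :: "complex \<Rightarrow> 'a \<Rightarrow>\<^sub>L 'b \<Rightarrow> 'a \<Rightarrow>\<^sub>L 'b"
  is "\<lambda>c f x. c *\<^sub>C f x"
proof -
  fix c :: complex and f :: "'a \<Rightarrow> 'b"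
  assume "bounded_linear f"
  then show "bounded_linear (\<lambda>x. c *\<^sub>C f x)"
    using bounded_linear_scaleC_blinfun[of c "Blinfun f"] by (simp add: bounded_linear_Blinfun_apply)
qed

instance
proof
  fix c d :: complex and r :: real and A B :: "'a \<Rightarrow>\<^sub>L 'b"
  show "c *\<^sub>C (A + B) = c *\<^sub>C A + c *\<^sub>C B"
    by (rule blinfun_eqI) (simp add: scaleC_blinfun.rep_eq blinfun.add_left scaleC_add_right)
  show "(c + d) *\<^sub>C A = c *\<^sub>C A + d *\<^sub>C A"
    by (rule blinfun_eqI) (simp add: scaleC_blinfun.rep_eq blinfun.add_left scaleC_add_left)
  show "c *\<^sub>C d *\<^sub>C A = (c * d) *\<^sub>C A"
    by (rule blinfun_eqI) (simp add: scaleC_blinfun.rep_eq scaleC_scaleC)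
  show "1 *\<^sub>C A = A"
    by (rule blinfun_eqI) (simp add: scaleC_blinfun.rep_eq scaleC_one)
  show "r *\<^sub>R A = complex_of_real r *\<^sub>C A"
    by (rule blinfun_eqI) (simp add: scaleC_blinfun.rep_eq blinfun.scaleR_left scaleR_scaleC)
  have le: "norm (e *\<^sub>C D) \<le> cmod e * norm D" for e and D :: "'a \<Rightarrow>\<^sub>L 'b"
  proof (rule norm_blinfun_bound)
    show "norm (blinfun_apply (e *\<^sub>C D) x) \<le> cmod e * norm D * norm x" for x
      using mult_left_mono[OF norm_blinfun[of D x], of "cmod e"]
      by (simp add: scaleC_blinfun.rep_eq norm_scaleC mult_ac)
  qed simp
  show "norm (c *\<^sub>C A) = cmod c * norm A"
  proof (cases "c = 0")
    case True
    then show ?thesis using le[of c A] by simp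
  next
    case False
    have "A = inverse c *\<^sub>C (c *\<^sub>C A)"
      by (rule blinfun_eqI) (simp add: scaleC_blinfun.rep_eq scaleC_scaleC scaleC_one False)
    then have "norm A \<le> cmod (inverse c) * norm (c *\<^sub>C A)"
      using le by metis
    then have "cmod c * norm A \<le> norm (c *\<^sub>C A)"
      using False by (simp add: norm_inverse inverse_eq_divide norm_divide pos_le_divide_eq mult.commute)
    then show ?thesis using le[of c A] by simp
  qed
qed

end

primrec op_power :: "('a::real_normed_vector \<Rightarrow>\<^sub>L 'a) \<Rightarrow> nat \<Rightarrow> 'a \<Rightarrow>\<^sub>L 'a" where
  "op_power T 0 = id_blinfun"
| "op_power T (Suc n) = T o\<^sub>L op_power T n"

text \<open>
  The library function \<open>exp\<close> does not apply, since its type class demands \<open>1 \<noteq> 0\<close>,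
  which fails for operators on the zero space.
\<close>

definition op_exp :: "('a::real_normed_vector \<Rightarrow>\<^sub>L 'a) \<Rightarrow> 'a \<Rightarrow>\<^sub>L 'a"
  where "op_exp T = (\<Sum>n. op_power T n /\<^sub>R fact n)"

definition op_poly :: "complex poly \<Rightarrow> ('a::complex_normed_vector \<Rightarrow>\<^sub>L 'a) \<Rightarrow> 'a \<Rightarrow>\<^sub>L 'a"
  where "op_poly p T = (\<Sum>i\<le>degree p. coeff p i *\<^sub>C op_power T i)"

definition algebraic_op :: "('a::complex_normed_vector \<Rightarrow>\<^sub>L 'a) \<Rightarrow> bool"
  where "algebraic_op T \<longleftrightarrow> (\<exists>p. p \<noteq> 0 \<and> op_poly p T = 0)"

definition is_minimal_poly :: "complex poly \<Rightarrow> ('a::complex_normed_vector \<Rightarrow>\<^sub>L 'a) \<Rightarrow> bool"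
  where "is_minimal_poly P T \<longleftrightarrow>
    lead_coeff P = 1 \<and> op_poly P T = 0 \<and>
    (\<forall>q. lead_coeff q = 1 \<and> op_poly q T = 0 \<longrightarrow> degree P \<le> degree q)"

section \<open>Bell polynomials\<close>

definition bell_poly :: "nat \<Rightarrow> complex poly"
  where "bell_poly j = (\<Sum>k\<le>j. monom (of_nat (Stirling j k)) k)"

end

theory Submission
  imports Defs
begin

text \<open>
  Inserting the Binet-type representation of the powers into the exponential series and exchanging
  the series with the finite double sum, the coefficient of \<open>C i j\<close> becomes
  \<open>\<Sum>n. n ^ j * lam i ^ n / fact n\<close>, and Dobinski's formula \<open>dobinski_sums\<close> evaluates that series
  to \<open>exp (lam i)\<close> times the value of the \<open>j\<close>-th Bell polynomial at \<open>lam i\<close>.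

  Dobinski's formula comes from writing \<open>n ^ j\<close> in the basis of falling factorials, where the
  coefficients are the Stirling numbers of the second kind (\<open>power_eq_sum_Stirling_binomial\<close>):
  against the weights \<open>x ^ n / fact n\<close> the falling factorial of order \<open>k\<close> merely shifts the
  exponential series by \<open>k\<close> places, so it contributes \<open>x ^ k * exp x\<close>
  (\<open>falling_factorial_exp_sums\<close>).
\<close>

text \<open>
  The falling factorial \<open>n (n - 1) ... (n - k + 1)\<close> is written \<open>fact k * (n choose k)\<close>.
  Multiplying it by \<open>n = k + (n - k)\<close> yields \<open>k\<close> times itself plus the falling factorial of order
  \<open>k + 1\<close>, and this matches the recurrence of the Stirling numbers.
\<close>

lemma power_eq_sum_Stirling_binomial:
  "n ^ j = (\<Sum>k\<le>j. Stirling j k * (fact k * (n choose k)))" for n j :: nat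
proof (induction j)
  case 0
  then show ?case by simp
next
  case (Suc j)
  let ?F = "\<lambda>k. fact k * (n choose k)"
  have step: "n * ?F k = k * ?F k + ?F (Suc k)" for k
  proof (cases "k \<le> n")
    case True
    have "Suc k * (n choose Suc k) = (n - k) * (n choose k)"
      by (simp only: binomial_absorption binomial_absorb_comp)
    then have "?F (Suc k) = (n - k) * ?F k"
      by (metis fact_Suc mult.assoc mult.left_commute of_nat_id)
    then show ?thesis
      using True by (simp add: add_mult_distrib[symmetric])
  next
    case False
    then show ?thesis by (simp add: binomial_eq_0)
  qed
  have "n ^ Suc j = (\<Sum>k\<le>j. Stirling j k * (n * ?F k))"
    by (simp add: Suc sum_distrib_left mult_ac)
  also have "\<dots> = (\<Sum>k\<le>j. k * Stirling j k * ?F k) + (\<Sum>k\<le>j. Stirling j k * ?F (Suc k))"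
    unfolding step by (simp add: algebra_simps sum.distrib)
  \<comment> \<open>Shifting the index drops the term at \<open>0\<close>, which has the factor \<open>0\<close>, and adds the one at
    \<open>Suc j\<close>, which has the factor \<open>Stirling j (Suc j) = 0\<close>.\<close>
  also have "(\<Sum>k\<le>j. k * Stirling j k * ?F k)
      = (\<Sum>k\<le>j. Suc k * Stirling j (Suc k) * ?F (Suc k))"
    using sum.atMost_Suc_shift[of "\<lambda>k. k * Stirling j k * ?F k" j]
    by simp
  also have "\<dots> + (\<Sum>k\<le>j. Stirling j k * ?F (Suc k))
      = (\<Sum>k\<le>j. Stirling (Suc j) (Suc k) * ?F (Suc k))"
    by (simp add: sum.distrib[symmetric] algebra_simps)
  also have "\<dots> = (\<Sum>k\<le>Suc j. Stirling (Suc j) k * ?F k)"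
    by (subst sum.atMost_Suc_shift) simp
  finally show ?case .
qed

lemma falling_factorial_exp_sums:
  fixes x :: complex
  shows "(\<lambda>n. of_nat (fact k * (n choose k)) * x ^ n / fact n) sums (x ^ k * exp x)"
proof (rule sums_zero_iff_shift[THEN iffD1])
  show "of_nat (fact k * (n choose k)) * x ^ n / fact n = 0" if "n < k" for n
    using that by simp
  have "of_nat (fact k * (n + k choose k)) * x ^ (n + k) / fact (n + k)
      = x ^ k * (x ^ n /\<^sub>R fact n)" for n
    by (simp add: binomial_fact power_add scaleR_conv_of_real field_simps)
  then show "(\<lambda>n. of_nat (fact k * (n + k choose k)) * x ^ (n + k) / fact (n + k))
      sums (x ^ k * exp x)"
    using sums_mult[OF exp_converges[of x], of "x ^ k"] by simp
qed

lemma dobinski_sums: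
  fixes x :: complex
  shows "(\<lambda>n. of_nat n ^ j * x ^ n / fact n) sums (exp x * poly (bell_poly j) x)"
proof -
  have "(\<lambda>n. \<Sum>k\<le>j. of_nat (Stirling j k) * (of_nat (fact k * (n choose k)) * x ^ n / fact n))
      sums (\<Sum>k\<le>j. of_nat (Stirling j k) * (x ^ k * exp x))"
    by (intro sums_sum sums_mult falling_factorial_exp_sums)
  moreover have "of_nat n ^ j * x ^ n / fact n
      = (\<Sum>k\<le>j. of_nat (Stirling j k) * (of_nat (fact k * (n choose k)) * x ^ n / fact n))" for n
  proof -
    have "(of_nat n :: complex) ^ j
        = (\<Sum>k\<le>j. of_nat (Stirling j k) * of_nat (fact k * (n choose k)))"
      by (subst of_nat_power[symmetric], subst power_eq_sum_Stirling_binomial)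
        (simp only: of_nat_sum of_nat_mult)
    then show ?thesis
      by (simp add: sum_distrib_right sum_divide_distrib mult.assoc)
  qed
  moreover have "exp x * poly (bell_poly j) x
      = (\<Sum>k\<le>j. of_nat (Stirling j k) * (x ^ k * exp x))"
    by (simp add: bell_poly_def poly_sum poly_monom sum_distrib_left mult_ac)
  ultimately show ?thesis by simp
qed

lemma bounded_linear_scaleC_left:
  "bounded_linear (\<lambda>c. c *\<^sub>C x)" for x :: "'a::complex_normed_vector"
  by (rule bounded_linear_intro[where K = "norm x"])
    (simp_all add: scaleC_add_left scaleR_scaleC scaleC_scaleC norm_scaleC scaleC_complex_def)

theorem proposition4p7:
  fixes T :: "'a::complex_hilbert_space \<Rightarrow>\<^sub>L 'a"
    and r s :: nat
    and a :: "nat \<Rightarrow> real"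
    and P :: "complex poly"
    and lam :: "nat \<Rightarrow> complex"
    and m :: "nat \<Rightarrow> nat"
    and C :: "nat \<Rightarrow> nat \<Rightarrow> 'a \<Rightarrow>\<^sub>L 'a"
  assumes "separable_space (euclidean :: 'a topology)"
    and "clinear_op T"
    and "algebraic_op T"
    and "r \<ge> 2"
    and "P = monom 1 r - (\<Sum>k<r. monom (complex_of_real (a k)) k)"
    and "is_minimal_poly P T"
    and "inj_on lam {1..s}"
    and "lam ` {1..s} = {z. poly P z = 0}"
    and "\<And>i. i \<in> {1..s} \<Longrightarrow> m i = order (lam i) P"
    and "\<And>i j. i \<in> {1..s} \<Longrightarrow> j < m i \<Longrightarrow> clinear_op (C i j)"
    and "\<And>n. op_power T n =
          (\<Sum>i=1..s. \<Sum>j<m i. (of_nat n ^ j * lam i ^ n) *\<^sub>C C i j)"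
  shows "op_exp T = (\<Sum>i=1..s. \<Sum>j<m i. (exp (lam i) * poly (bell_poly j) (lam i)) *\<^sub>C C i j)"
proof -
  have "(\<lambda>n. \<Sum>i=1..s. \<Sum>j<m i. (of_nat n ^ j * lam i ^ n / fact n) *\<^sub>C C i j)
      sums (\<Sum>i=1..s. \<Sum>j<m i. (exp (lam i) * poly (bell_poly j) (lam i)) *\<^sub>C C i j)"
    by (intro sums_sum bounded_linear.sums[OF bounded_linear_scaleC_left] dobinski_sums)
  moreover have "op_power T n /\<^sub>R fact n
      = (\<Sum>i=1..s. \<Sum>j<m i. (of_nat n ^ j * lam i ^ n / fact n) *\<^sub>C C i j)" for n
    unfolding assms(11) scaleR_sum_right
    by (simp add: scaleR_scaleC scaleC_scaleC divide_inverse mult.commute)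
  ultimately show ?thesis
    by (simp add: op_exp_def sums_iff)
qed

end
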